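(* Let $\ell\geq1$, $h\geq1$, $1\leq d\leq h$, and let $\mu=(h,1,1,\dotsc,1)$ be the hook with $\ell+1$ parts (so $\mu_0=h$ and $\mu_1=\cdots=\mu_\ell=1$). Then \[ B_{\mu,d}(x,t)=x+x^{\ell+1}\,\frac{\bigl(1+t(x+x^2+\cdots+x^\ell)\bigr)^d-1}{x+x^2+\cdots+x^\ell} = x+\sum_{k=1}^{d}t^k\binom{d}{k}x^{\ell+1}(x+x^2+\cdots+x^\ell)^{k-1}. \] In particular, for $\ell=1$ and $d=h$, one has $\mathbf{F}_{\mu,d}(x,t)=\dfrac{1}{1-x(1+xt)^d}$.
   Context: For a partition $\mu=(\mu_0\geq\cdots\geq\mu_\ell\geq1)$: an anchor word of length $n$ is a word $a_1\cdots a_n$ over $\{1,\dotsc,d,\infty\}$ such that $a_i\neq\infty$ implies $a_{i+k}\geq a_i+\mu_k$ for $k=1,\dotsc,\ell$ ($\infty$ larger than every integer) and $a_{n-\ell+1}=\cdots=a_n=\infty$. $\mathrm{bigtiles}(w)$ is the number of non-$\infty$ letters and $\mathrm{width}(w)$ the length. A fault-free anchor word is either $(\infty)$ or a word starting with an integer, ending with $\ell$ consecutive $\infty$'s, with that final block being the only occurrence of $\ell$ consecutive $\infty$'s. $B_{\mu,d}(x,t)=\sum x^{\mathrm{width}(w)}t^{\mathrm{bigtiles}(w)}$ over fault-free anchor words, and $\mathbf{F}_{\mu,d}(x,t)=\sum_{n\geq0}\sum_{w}t^{\mathrm{bigtiles}(w)}x^n$ over all anchor words $w$ of length $n$. *)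

theory Defs
  imports
    "HOL-Computational_Algebra.Formal_Power_Series"
    "HOL-Library.Extended_Nat"
begin

text \<open>
  A partition \<open>\<mu>\<^sub>0 \<ge> \<dots> \<ge> \<mu>\<^sub>\<ell> \<ge> 1\<close> is the list \<open>[\<mu>\<^sub>0, \<dots>, \<mu>\<^sub>\<ell>]\<close>, so that \<open>\<ell>\<close> is one less than
  its length.  Words are lists indexed from 0: the letter \<open>a\<^sub>i\<close> is \<open>w ! (i - 1)\<close>.
\<close>

definition ell :: "nat list \<Rightarrow> nat" where
  "ell \<mu> = length \<mu> - 1"

definition hook :: "nat \<Rightarrow> nat \<Rightarrow> nat list" where
  "hook h l = h # replicate l 1"

text \<open>
  The last condition says that the final \<open>\<ell>\<close> letters are \<open>\<infinity>\<close>; if the word is shorter than \<open>\<ell>\<close>,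
  it says that all letters are \<open>\<infinity>\<close>.  It also makes the bound \<open>i + k < length w\<close> automatic,
  because an integer letter has at least \<open>\<ell>\<close> letters after it.
\<close>

definition anchor_word :: "nat list \<Rightarrow> nat \<Rightarrow> enat list \<Rightarrow> bool" where
  "anchor_word \<mu> d w \<longleftrightarrow>
     set w \<subseteq> enat ` {1..d} \<union> {\<infinity>} \<and>
     (\<forall>i < length w. w ! i \<noteq> \<infinity> \<longrightarrow>
        (\<forall>k \<in> {1..ell \<mu>}. i + k < length w \<longrightarrow> w ! (i + k) \<ge> w ! i + enat (\<mu> ! k))) \<and>
     (\<forall>i < length w. length w \<le> i + ell \<mu> \<longrightarrow> w ! i = \<infinity>)"

definition bigtiles :: "enat list \<Rightarrow> nat" where
  "bigtiles w = card {i. i < length w \<and> w ! i \<noteq> \<infinity>}"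

definition inf_block :: "nat \<Rightarrow> enat list \<Rightarrow> nat \<Rightarrow> bool" where
  "inf_block m w i \<longleftrightarrow> i + m \<le> length w \<and> (\<forall>j < m. w ! (i + j) = \<infinity>)"

definition fault_free :: "nat list \<Rightarrow> nat \<Rightarrow> enat list \<Rightarrow> bool" where
  "fault_free \<mu> d w \<longleftrightarrow>
     anchor_word \<mu> d w \<and>
     (w = [\<infinity>] \<or>
      w \<noteq> [] \<and> hd w \<noteq> \<infinity> \<and> ell \<mu> \<le> length w \<and>
      {i. inf_block (ell \<mu>) w i} = {length w - ell \<mu>})"

text \<open>
  Bivariate series are power series in \<open>x\<close> (outer) whose coefficients are power series in \<open>t\<close>
  (inner).  With this nesting the division of power series can be used for a denominator such as
  \<open>x + \<dots> + x\<^sup>\<ell>\<close>, whose lowest coefficient 1 is a unit; the lemma \<open>div_geometric\<close> below confirms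
  that the quotient is the expected one.
\<close>

abbreviation (input) varx :: "rat fps fps" where
  "varx \<equiv> fps_X"

abbreviation (input) vart :: "rat fps fps" where
  "vart \<equiv> fps_const fps_X"

definition Bseries :: "nat list \<Rightarrow> nat \<Rightarrow> rat fps fps" where
  "Bseries \<mu> d = Abs_fps (\<lambda>n. \<Sum>w \<in> {w. fault_free \<mu> d w \<and> length w = n}. fps_X ^ bigtiles w)"

definition Fseries :: "nat list \<Rightarrow> nat \<Rightarrow> rat fps fps" where
  "Fseries \<mu> d = Abs_fps (\<lambda>n. \<Sum>w \<in> {w. anchor_word \<mu> d w \<and> length w = n}. fps_X ^ bigtiles w)"

lemma finite_anchor_words: "finite {w. anchor_word \<mu> d w \<and> length w = n}"
  by (rule finite_subset[OF _ finite_lists_length_eq[of "enat ` {1..d} \<union> {\<infinity>}" n]])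
     (auto simp: anchor_word_def)

lemma finite_fault_free: "finite {w. fault_free \<mu> d w \<and> length w = n}"
  by (rule finite_subset[OF _ finite_anchor_words[of \<mu> d n]]) (auto simp: fault_free_def)

lemma fps_times_divide_unit_lead:
  fixes f g :: "'a::{comm_ring_1,inverse} fps"
  assumes "fps_nth g (subdegree g) * inverse (fps_nth g (subdegree g)) = 1"
  shows "(f * g) / g = f"
proof -
  have "g * inverse (unit_factor g) = fps_X ^ subdegree g"
    unfolding fps_inverse_def
    by (rule fps_mult_right_inverse_unit_factor) (use assms in simp)
  then show ?thesis
    by (simp add: fps_divide_def mult.assoc fps_shift_times_fps_X_power)
qed

lemma div_geometric:
  fixes Q :: "rat fps fps"
  assumes "l \<ge> 1"
  shows "(Q * (\<Sum>i=1..l. varx ^ i)) / (\<Sum>i=1..l. varx ^ i) = Q"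
proof -
  let ?S = "\<Sum>i=1..l. varx ^ i"
  have n: "fps_nth ?S k = (if k \<in> {1..l} then 1 else 0)" for k
    by (simp add: fps_sum_nth fps_X_power_nth eq_commute[of k])
  have s: "subdegree ?S = 1"
    by (rule subdegreeI) (use assms n in auto)
  have "fps_nth ?S (subdegree ?S) = 1"
    using assms unfolding s n by simp
  then show ?thesis
    by (intro fps_times_divide_unit_lead) (simp only: fps_inverse_one mult_1_left)
qed

end

theory Submission
  imports Defs
begin

text \<open>
  For a hook only the order of nearby letters matters: an integer must be smaller than each of the
  next \<open>\<ell>\<close> letters.  Let \<open>P\<^sub>a\<close> count the fault-free words whose first letter is an integer above
  \<open>a\<close>, and put \<open>S = x + \<dots> + x\<^sup>\<ell>\<close>.  After the first letter of such a word there are either exactly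
  \<open>\<ell>\<close> letters \<open>\<infinity>\<close>, or fewer than \<open>\<ell>\<close> of them and then a fault-free word with a larger first letter.
  Hence \<open>P\<^sub>a = P\<^sub>a\<^sub>+\<^sub>1 + t (x\<^sup>\<ell>\<^sup>+\<^sup>1 + S P\<^sub>a\<^sub>+\<^sub>1)\<close>, so \<open>S P\<^sub>a + x\<^sup>\<ell>\<^sup>+\<^sup>1\<close> is multiplied by \<open>1 + t S\<close> at each
  step down from \<open>P\<^sub>d = 0\<close>.  For \<open>\<ell> = 1\<close>, splitting off the first letter gives in the same way
  \<open>F = 1 + x (1 + x t)\<^sup>d F\<close>.
\<close>

section \<open>Weighted series of sets of words\<close>

definition length_finite :: "'a list set \<Rightarrow> bool" where
  "length_finite A \<longleftrightarrow> (\<forall>n. finite {w \<in> A. length w = n})"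

definition word_series :: "enat list set \<Rightarrow> rat fps fps" where
  "word_series A = Abs_fps (\<lambda>n. \<Sum>w \<in> {w \<in> A. length w = n}. fps_X ^ bigtiles w)"

lemma length_finite_Un: "length_finite A \<Longrightarrow> length_finite B \<Longrightarrow> length_finite (A \<union> B)"
  unfolding length_finite_def by (simp add: Collect_disj_eq conj_disj_distribR)

lemma length_finite_finite: "finite A \<Longrightarrow> length_finite A"
  unfolding length_finite_def by simp

lemma length_finite_append_image:
  assumes "length_finite A"
  shows "length_finite ((@) p ` A)"
  unfolding length_finite_def
proof
  fix n
  have "{w \<in> (@) p ` A. length w = n} \<subseteq> (@) p ` {w \<in> A. length w = n - length p}"
    by auto
  then show "finite {w \<in> (@) p ` A. length w = n}"
    using assms unfolding length_finite_def by (meson finite_imageI finite_subset)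
qed

lemma length_finite_UN:
  assumes "finite I" "\<And>i. i \<in> I \<Longrightarrow> length_finite (A i)"
  shows "length_finite (\<Union>i\<in>I. A i)"
  using assms
  by (induction I) (simp_all add: length_finite_Un length_finite_finite)

lemma bigtiles_eq: "bigtiles w = length (filter (\<lambda>c. c \<noteq> \<infinity>) w)"
  by (simp add: bigtiles_def length_filter_conv_card)

lemma word_series_empty [simp]: "word_series {} = 0"
  by (simp add: word_series_def fps_eq_iff)

text \<open>\<open>sum\<close> over an infinite set is 0, so additivity is claimed only for sets
  with finitely many words of each length.\<close>

lemma word_series_Un:
  assumes "length_finite A" "length_finite B" "A \<inter> B = {}"
  shows "word_series (A \<union> B) = word_series A + word_series B"
proof (rule fps_ext)
  fix n
  have "{w \<in> A \<union> B. length w = n} = {w \<in> A. length w = n} \<union> {w \<in> B. length w = n}"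
    by auto
  then show "fps_nth (word_series (A \<union> B)) n = fps_nth (word_series A + word_series B) n"
    using assms unfolding word_series_def length_finite_def
    by (simp, subst sum.union_disjoint) auto
qed

lemma word_series_UN:
  assumes "finite I" "\<And>i. i \<in> I \<Longrightarrow> length_finite (A i)"
    and "\<And>i j. i \<in> I \<Longrightarrow> j \<in> I \<Longrightarrow> i \<noteq> j \<Longrightarrow> A i \<inter> A j = {}"
  shows "word_series (\<Union>i\<in>I. A i) = (\<Sum>i\<in>I. word_series (A i))"
  using assms
proof (induction I)
  case (insert i I)
  have "A i \<inter> (\<Union>j\<in>I. A j) = {}"
    using insert.prems(2) insert.hyps(2) by blast
  then have "word_series (A i \<union> (\<Union>j\<in>I. A j)) = word_series (A i) + word_series (\<Union>j\<in>I. A j)"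
    using insert by (intro word_series_Un length_finite_UN) auto
  then show ?case
    using insert by simp
qed simp

text \<open>Prefixing \<open>p\<close> is injective, raises every length by \<open>length p\<close>,
  and adds \<open>bigtiles p\<close> to the number of integer letters.\<close>

lemma word_series_append_image:
  "word_series ((@) p ` A) = vart ^ bigtiles p * varx ^ length p * word_series A"
proof (rule fps_ext)
  fix n
  have set_eq: "{w \<in> (@) p ` A. length w = n} =
      (if n < length p then {} else (@) p ` {w \<in> A. length w = n - length p})"
    by auto
  have "fps_nth (word_series ((@) p ` A)) n =
      (if n < length p then 0 else fps_X ^ bigtiles p * fps_nth (word_series A) (n - length p))"
    unfolding word_series_def
    by (simp add: set_eq sum.reindex inj_on_def bigtiles_eq power_add sum_distrib_left)
  also have "\<dots> = fps_nth (vart ^ bigtiles p * varx ^ length p * word_series A) n"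
    by (simp add: mult.assoc fps_X_power_mult_nth fps_const_power)
  finally show "fps_nth (word_series ((@) p ` A)) n =
      fps_nth (vart ^ bigtiles p * varx ^ length p * word_series A) n" .
qed

lemma word_series_single: "word_series {w} = vart ^ bigtiles w * varx ^ length w"
proof -
  have "word_series {[]} = 1"
    by (rule fps_ext) (auto simp: word_series_def bigtiles_def)
  then show ?thesis
    using word_series_append_image[of w "{[]}"] by simp
qed

section \<open>Anchor words of a hook\<close>

lemma ell_hook [simp]: "ell (hook h l) = l"
  by (simp add: ell_def hook_def)

text \<open>The parts of index 1 to \<open>l\<close> equal 1, and for an integer letter
  \<open>a\<close> the inequality \<open>a + 1 \<le> b\<close> means \<open>a < b\<close>, also when
  \<open>b = \<infinity>\<close>. The end condition, contraposed, says that every integer has at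
  least \<open>l\<close> letters after it, which absorbs the bound on \<open>i + k\<close>.\<close>

lemma anchor_word_hook:
  "anchor_word (hook h l) d w \<longleftrightarrow>
     set w \<subseteq> enat ` {1..d} \<union> {\<infinity>} \<and>
     (\<forall>i < length w. w ! i \<noteq> \<infinity> \<longrightarrow> i + l < length w \<and> (\<forall>k \<in> {1..l}. w ! i < w ! (i + k)))"
proof -
  have step: "a + enat (hook h l ! k) \<le> b \<longleftrightarrow> a < b"
    if "a \<noteq> \<infinity>" "k \<in> {1..l}" for a b k
  proof -
    have "hook h l ! k = 1"
      using that(2) by (cases k) (auto simp: hook_def)
    then show ?thesis
      using that(1) by (cases a; cases b) auto
  qed
  have "(\<forall>i < length w. length w \<le> i + l \<longrightarrow> w ! i = \<infinity>) \<longleftrightarrow>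
      (\<forall>i < length w. w ! i \<noteq> \<infinity> \<longrightarrow> i + l < length w)"
    by (meson not_le)
  moreover have "i + k < length w" if "i + l < length w" "k \<in> {1..l}" for i k
    using that by simp
  ultimately show ?thesis
    unfolding anchor_word_def ell_hook using step by (smt (verit))
qed

text \<open>Each condition looks only forward from its letter, so those of the tail are unchanged
  when a letter is put in front. This is the recursion behind all decompositions below.\<close>

lemma anchor_word_hook_Cons:
  "anchor_word (hook h l) d (c # v) \<longleftrightarrow>
     c \<in> enat ` {1..d} \<union> {\<infinity>} \<and> (c \<noteq> \<infinity> \<longrightarrow> l \<le> length v \<and> (\<forall>k < l. c < v ! k)) \<and>
     anchor_word (hook h l) d v"
proof -
  have near: "(\<forall>k \<in> {1..l}. c < (c # v) ! k) \<longleftrightarrow> (\<forall>k < l. c < v ! k)"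
    by (metis (no_types, lifting) One_nat_def Suc_le_eq Suc_pred atLeastAtMost_iff
        le_add1 nth_Cons_Suc plus_1_eq_Suc zero_less_Suc)
  show ?thesis
    unfolding anchor_word_hook length_Cons All_less_Suc2 nth_Cons_0 nth_Cons_Suc add_0 add_Suc
      Suc_less_eq near
    by (auto simp: less_Suc_eq_le)
qed

lemma anchor_word_replicate_append [simp]:
  "anchor_word (hook h l) d (replicate j \<infinity> @ w) \<longleftrightarrow> anchor_word (hook h l) d w"
  by (induction j) (auto simp: anchor_word_hook_Cons)

lemma anchor_word_Nil [simp]: "anchor_word \<mu> d []"
  by (simp add: anchor_word_def)

lemma anchor_word_replicate [simp]: "anchor_word (hook h l) d (replicate j \<infinity>)"
  using anchor_word_replicate_append[of h l d j "[]"] by simp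

lemma length_finite_anchor: "length_finite {w. anchor_word \<mu> d w \<and> P w}"
  using finite_anchor_words[of \<mu> d] unfolding length_finite_def
  by (auto intro: finite_subset[rotated])

section \<open>Position of the blocks of \<open>l\<close> infinities\<close>

lemma inf_block_append: "inf_block m (p @ w) (length p + i) \<longleftrightarrow> inf_block m w i"
  by (simp add: inf_block_def nth_append add.assoc)

text \<open>The block clause of \<open>fault_free\<close> on its own, so that it can also be applied
  to tails that begin with \<open>\<infinity>\<close>.\<close>

definition terminal_block :: "nat \<Rightarrow> enat list \<Rightarrow> bool" where
  "terminal_block l w \<longleftrightarrow> l \<le> length w \<and> {i. inf_block l w i} = {length w - l}"

lemma terminal_block_replicate:
  assumes "l \<ge> 1"
  shows "terminal_block l (replicate j \<infinity>) \<longleftrightarrow> j = l"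
proof
  assume t: "terminal_block l (replicate j \<infinity>)"
  then have "inf_block l (replicate j \<infinity>) 0"
    by (simp add: terminal_block_def inf_block_def)
  then have "0 \<in> {j - l}"
    using t unfolding terminal_block_def by (metis length_replicate mem_Collect_eq)
  then show "j = l"
    using t by (simp add: terminal_block_def)
next
  assume "j = l"
  then show "terminal_block l (replicate j \<infinity>)"
    by (auto simp: terminal_block_def inf_block_def)
qed

text \<open>If no block starts inside \<open>p\<close>, the set of block positions is that of
  \<open>w\<close> shifted by \<open>length p\<close>. The bound \<open>l \<le> length w\<close>
  makes the truncated difference \<open>length w - l\<close> shift in the same way, and shifting is
  injective on sets.\<close>

lemma terminal_block_append:
  assumes "\<And>i. i < length p \<Longrightarrow> \<not> inf_block l (p @ w) i" "l \<le> length w"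
  shows "terminal_block l (p @ w) \<longleftrightarrow> terminal_block l w"
proof -
  have "{i. inf_block l (p @ w) i} = (+) (length p) ` {i. inf_block l w i}"
  proof (intro set_eqI iffI)
    fix i assume "i \<in> {i. inf_block l (p @ w) i}"
    then have b: "inf_block l (p @ w) i" by simp
    then obtain m where m: "i = length p + m"
      using assms(1) by (meson le_Suc_ex not_le)
    then show "i \<in> (+) (length p) ` {i. inf_block l w i}"
      using b by (auto simp: inf_block_append)
  qed (auto simp: inf_block_append)
  moreover have "{length (p @ w) - l} = (+) (length p) ` {length w - l}"
    using assms(2) by auto
  moreover have "inj ((+) (length p))"
    by simp
  ultimately show ?thesis
    unfolding terminal_block_def using assms(2) by (metis inj_image_eq_iff length_append trans_le_add2)
qed

lemma terminal_block_Cons: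
  assumes "l \<ge> 1" "c \<noteq> \<infinity>" "l \<le> length v"
  shows "terminal_block l (c # v) \<longleftrightarrow> terminal_block l v"
proof -
  have "\<not> inf_block l ([c] @ v) i" if "i < length [c]" for i
  proof
    assume "inf_block l ([c] @ v) i"
    \<comment> \<open>Since \<open>l \<ge> 1\<close>, the block contains its own starting
      position.\<close>
    then have "([c] @ v) ! (i + 0) = \<infinity>"
      using assms(1) unfolding inf_block_def by fastforce
    then show False using that assms(2) by simp
  qed
  from terminal_block_append[OF this assms(3)] show ?thesis by simp
qed

text \<open>If \<open>j < l\<close>, a block starting before \<open>w\<close> would cover the
  integer \<open>hd w\<close>. If \<open>j \<ge> l\<close>, there is a block at position 0, which is
  too early because \<open>w\<close> is longer than \<open>l\<close>.\<close>

lemma terminal_block_replicate_append: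
  assumes "hd w \<noteq> \<infinity>" "l < length w"
  shows "terminal_block l (replicate j \<infinity> @ w) \<longleftrightarrow> j < l \<and> terminal_block l w"
proof (cases "j < l")
  case True
  have "\<not> inf_block l (replicate j \<infinity> @ w) i" if "i < length (replicate j (\<infinity>::enat))" for i
  proof
    assume "inf_block l (replicate j \<infinity> @ w) i"
    \<comment> \<open>Position \<open>j\<close>, where \<open>hd w\<close> stands, has offset
      \<open>j - i\<close> within a block starting at \<open>i\<close>.\<close>
    moreover have "j - i < l" "i + (j - i) = j" using True that by auto
    ultimately have "(replicate j \<infinity> @ w) ! j = \<infinity>"
      unfolding inf_block_def by metis
    then show False
      using assms by (simp add: nth_append hd_conv_nth flip: length_greater_0_conv)
  qed
  then show ?thesis
    using terminal_block_append[of "replicate j \<infinity>" l w] assms True by simp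
next
  case False
  then have "inf_block l (replicate j \<infinity> @ w) 0"
    by (auto simp: inf_block_def nth_append)
  moreover have "0 \<noteq> length (replicate j \<infinity> @ w) - l"
    using assms(2) by simp
  ultimately show ?thesis
    using False unfolding terminal_block_def by blast
qed

section \<open>Fault-free words with a lower bound on the first letter\<close>

definition ff_above :: "nat \<Rightarrow> nat \<Rightarrow> nat \<Rightarrow> nat \<Rightarrow> enat list set" where
  "ff_above h l d a = {w. anchor_word (hook h l) d w \<and>
     (w \<noteq> [] \<and> hd w \<noteq> \<infinity> \<and> enat a < hd w \<and> terminal_block l w)}"

lemma length_finite_ff_above: "length_finite (ff_above h l d a)"
  unfolding ff_above_def by (rule length_finite_anchor)

lemma ff_above_top: "ff_above h l d d = {}"
proof -
  have "\<not> enat d < hd w" if "anchor_word (hook h l) d w" "w \<noteq> []" "hd w \<noteq> \<infinity>" for w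
    using that by (cases w) (auto simp: anchor_word_hook_Cons)
  then show ?thesis by (auto simp: ff_above_def)
qed

lemma split_leading_infinities:
  obtains j and v where "w = replicate j (\<infinity>::enat) @ v" "v = [] \<or> hd v \<noteq> \<infinity>"
proof
  let ?P = "\<lambda>c. c = (\<infinity>::enat)"
  have "takeWhile ?P w = replicate (length (takeWhile ?P w)) \<infinity>"
    by (rule replicate_eqI) (auto dest: set_takeWhileD)
  then show "w = replicate (length (takeWhile ?P w)) \<infinity> @ dropWhile ?P w"
    by (metis takeWhile_dropWhile_id)
  show "dropWhile ?P w = [] \<or> hd (dropWhile ?P w) \<noteq> \<infinity>"
    using hd_dropWhile by blast
qed

lemma anchor_word_finite_hd_length:
  assumes "anchor_word (hook h l) d w" "w \<noteq> []" "hd w \<noteq> \<infinity>"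
  shows "l < length w"
  using assms by (cases w) (auto simp: anchor_word_hook_Cons)

text \<open>Removing the integer in front does not affect the blocks. If the infinities that follow
  exhaust the word, they form exactly one block; otherwise there are fewer than \<open>l\<close> of
  them and the next integer is close enough to be compared with \<open>Suc a\<close>.\<close>

lemma ff_above_Cons_iff:
  assumes "l \<ge> 1" "Suc a \<le> d"
  shows "enat (Suc a) # u \<in> ff_above h l d a \<longleftrightarrow>
    u = replicate l \<infinity> \<or> (\<exists>j<l. \<exists>v \<in> ff_above h l d (Suc a). u = replicate j \<infinity> @ v)"
    (is "?L \<longleftrightarrow> ?R")
proof -
  have L: "?L \<longleftrightarrow> l \<le> length u \<and> (\<forall>k<l. enat (Suc a) < u ! k) \<and>
      anchor_word (hook h l) d u \<and> terminal_block l u"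
    using assms terminal_block_Cons[of l "enat (Suc a)" u]
    by (auto simp: ff_above_def anchor_word_hook_Cons)
  show ?thesis
  proof
    assume ?L
    then have l: "l \<le> length u" and gt: "\<forall>k<l. enat (Suc a) < u ! k"
      and anch: "anchor_word (hook h l) d u" and t: "terminal_block l u"
      using L by auto
    obtain j v where u: "u = replicate j \<infinity> @ v" and v: "v = [] \<or> hd v \<noteq> \<infinity>"
      by (rule split_leading_infinities)
    show ?R
    proof (cases "v = []")
      case True
      then show ?thesis
        using t u assms(1) by (simp add: terminal_block_replicate)
    next
      case False
      have av: "anchor_word (hook h l) d v" using anch u by simp
      have lv: "l < length v"
        using anchor_word_finite_hd_length[OF av False] False v by blast
      have "j < l" "terminal_block l v"
        using terminal_block_replicate_append[of v l j] lv v False t u by auto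
      \<comment> \<open>The letter \<open>hd v\<close> is \<open>u ! j\<close> with
        \<open>j < l\<close>, so it lies within reach of the first letter.\<close>
      moreover have "enat (Suc a) < hd v"
        using gt \<open>j < l\<close> False u by (metis hd_conv_nth length_replicate nth_append_length_plus add_0_right)
      ultimately have "v \<in> ff_above h l d (Suc a)"
        using av v False by (simp add: ff_above_def)
      then show ?thesis using u \<open>j < l\<close> by blast
    qed
  next
    assume ?R
    then show ?L
    proof (elim disjE exE conjE bexE)
      assume "u = replicate l \<infinity>"
      then show ?L
        using L terminal_block_replicate[OF assms(1), of l] by simp
    next
      fix j v assume j: "j < l" and v: "v \<in> ff_above h l d (Suc a)" and u: "u = replicate j \<infinity> @ v"
      have av: "anchor_word (hook h l) d v" and ne: "v \<noteq> []" and hv: "hd v \<noteq> \<infinity>"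
        and gt: "enat (Suc a) < hd v" and t: "terminal_block l v"
        using v by (auto simp: ff_above_def)
      have lv: "l < length v"
        using anchor_word_finite_hd_length[OF av ne hv] .
      \<comment> \<open>Transitivity through \<open>hd v\<close>: it exceeds \<open>Suc a\<close>,
        and the letters of \<open>v\<close> that follow it within distance \<open>l\<close> exceed
        \<open>hd v\<close>.\<close>
      have near: "enat (Suc a) < v ! k" if "k < l" for k
      proof (cases "k = 0")
        case True
        then show ?thesis using gt ne by (simp add: hd_conv_nth)
      next
        case False
        then have "hd v < v ! k"
          using av ne hv that by (cases v) (auto simp: anchor_word_hook_Cons gr0_conv_Suc)
        then show ?thesis using gt by order
      qed
      have "\<forall>k<l. enat (Suc a) < u ! k"
        using near by (simp add: u nth_append)
      then show ?L
        using L av t j lv hv u terminal_block_replicate_append[of v l j] by simp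
    qed
  qed
qed

text \<open>A first letter above \<open>a\<close> is either above \<open>Suc a\<close> or equal to
  it; the second case is resolved by \<open>ff_above_Cons_iff\<close>.\<close>

lemma ff_above_decomp:
  assumes "l \<ge> 1" "Suc a \<le> d"
  shows "ff_above h l d a = ff_above h l d (Suc a) \<union> ({enat (Suc a) # replicate l \<infinity>} \<union>
    (\<Union>j<l. (@) (enat (Suc a) # replicate j \<infinity>) ` ff_above h l d (Suc a)))"
    (is "_ = _ \<union> ?R")
proof -
  have R: "w \<in> ?R \<longleftrightarrow> (\<exists>u. w = enat (Suc a) # u \<and> enat (Suc a) # u \<in> ff_above h l d a)" for w
    unfolding ff_above_Cons_iff[OF assms] by auto
  have "w \<in> ff_above h l d a \<longleftrightarrow> w \<in> ff_above h l d (Suc a) \<or>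
      (\<exists>u. w = enat (Suc a) # u \<and> enat (Suc a) # u \<in> ff_above h l d a)" for w
  proof (cases w)
    case (Cons c u)
    show ?thesis
    proof (cases c)
      case (enat m)
      then show ?thesis
        using Cons by (cases "m = Suc a") (auto simp: ff_above_def)
    qed (use Cons in \<open>auto simp: ff_above_def\<close>)
  qed (auto simp: ff_above_def)
  then show ?thesis
    unfolding set_eq_iff Un_iff[of _ _ ?R] R by blast
qed

text \<open>The number of copies of \<open>c\<close> can be read off the word, because what follows
  them starts with another letter.\<close>

lemma replicate_append_disjoint:
  assumes "i \<noteq> j" "\<And>w. w \<in> A \<Longrightarrow> w \<noteq> [] \<and> hd w \<noteq> c"
  shows "(@) (b # replicate i c) ` A \<inter> (@) (b # replicate j c) ` A = {}"
proof -
  have "takeWhile (\<lambda>x. x = c) (replicate k c @ w) = replicate k c" if "w \<in> A" for k w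
    using assms(2)[OF that] by (induction k) (cases w, auto)
  then show ?thesis
    using assms(1) by auto (metis length_replicate)
qed

lemma bigtiles_Cons_replicate [simp]: "bigtiles (enat b # replicate j \<infinity>) = 1"
  by (simp add: bigtiles_eq)

lemma word_series_ff_above_step:
  assumes "l \<ge> 1" "Suc a \<le> d"
  shows "word_series (ff_above h l d a) = word_series (ff_above h l d (Suc a)) +
    vart * (varx ^ (l + 1) + (\<Sum>i=1..l. varx ^ i) * word_series (ff_above h l d (Suc a)))"
proof -
  let ?T = "ff_above h l d (Suc a)"
  let ?J = "\<lambda>j. (@) (enat (Suc a) # replicate j \<infinity>) ` ?T"
  let ?e = "enat (Suc a) # replicate l \<infinity>"
  have hd: "w \<noteq> [] \<and> hd w \<noteq> \<infinity>" if "w \<in> ?T" for w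
    using that by (simp add: ff_above_def)
  have fin: "length_finite (?J j)" for j
    by (intro length_finite_append_image length_finite_ff_above)
  have fin_J: "length_finite (\<Union>j<l. ?J j)"
    by (intro length_finite_UN fin finite_lessThan)
  have fin_e: "length_finite {?e}"
    by (simp add: length_finite_finite)
  have e: "{?e} \<inter> (\<Union>j<l. ?J j) = {}"
  proof -
    have "set w \<subseteq> {\<infinity>} \<Longrightarrow> w \<notin> ?T" for w
      using hd hd_in_set by blast
    moreover have "set w \<subseteq> {\<infinity>}" if "replicate l \<infinity> = replicate j \<infinity> @ w" for j w
      using arg_cong[OF that, of set] by (auto split: if_splits)
    ultimately show ?thesis by auto
  qed
  have J: "word_series (\<Union>j<l. ?J j) = (\<Sum>j<l. word_series (?J j))"
    by (intro word_series_UN fin replicate_append_disjoint hd) auto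
  have T: "?T \<inter> ({?e} \<union> (\<Union>j<l. ?J j)) = {}"
    by (auto simp: ff_above_def)
  \<comment> \<open>The prefix with \<open>j\<close> infinities has length \<open>j + 1\<close>, so
    the exponents run from 1 to \<open>l\<close>.\<close>
  have sum: "(\<Sum>j<l. varx ^ Suc j) = (\<Sum>i=1..l. varx ^ i)"
    by (rule sum.reindex_bij_witness[of _ "\<lambda>i. i - 1" Suc]) auto
  have "word_series (ff_above h l d a) =
      word_series ?T + (word_series {?e} + (\<Sum>j<l. word_series (?J j)))"
    unfolding ff_above_decomp[OF assms]
    by (simp only: word_series_Un[OF length_finite_ff_above length_finite_Un[OF fin_e fin_J] T]
        word_series_Un[OF fin_e fin_J e] J)
  also have "(\<Sum>j<l. word_series (?J j)) = vart * ((\<Sum>j<l. varx ^ Suc j) * word_series ?T)"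
    unfolding word_series_append_image
    by (simp add: sum_distrib_left sum_distrib_right mult.assoc del: power_Suc)
  also have "word_series {?e} = vart * varx ^ (l + 1)"
    by (simp add: word_series_single del: power_Suc)
  finally show ?thesis
    unfolding sum by (simp add: distrib_left)
qed

text \<open>Counting by \<open>m = d - a\<close> turns the descent from \<open>d\<close> into an
  ordinary induction. Adding \<open>varx ^ (l + 1)\<close> makes the affine recurrence purely
  multiplicative.\<close>

lemma word_series_ff_above:
  fixes h l d :: nat
  defines "S \<equiv> \<Sum>i=1..l. varx ^ i"
  assumes "l \<ge> 1" "m \<le> d"
  shows "S * word_series (ff_above h l d (d - m)) + varx ^ (l + 1) =
    varx ^ (l + 1) * (1 + vart * S) ^ m"
  using assms(3)
proof (induction m)
  case 0
  then show ?case by (simp add: ff_above_top)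
next
  case (Suc m)
  have "word_series (ff_above h l d (d - Suc m)) = word_series (ff_above h l d (d - m)) +
      vart * (varx ^ (l + 1) + S * word_series (ff_above h l d (d - m)))"
    using word_series_ff_above_step[OF assms(2), of "d - Suc m" d h] Suc.prems
    by (simp add: S_def Suc_diff_Suc)
  then have "S * word_series (ff_above h l d (d - Suc m)) + varx ^ (l + 1) =
      (1 + vart * S) * (S * word_series (ff_above h l d (d - m)) + varx ^ (l + 1))"
    by (simp add: algebra_simps)
  then show ?case
    using Suc by (simp add: mult_ac)
qed

text \<open>Integer letters are at least 1, so the bound 0 excludes nothing; the remaining
  fault-free word \<open>[\<infinity>]\<close> contributes \<open>varx\<close>.\<close>

lemma Bseries_hook:
  assumes "l \<ge> 1"
  shows "Bseries (hook h l) d = varx + word_series (ff_above h l d 0)"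
proof -
  have inf: "anchor_word (hook h l) d [\<infinity>]"
    by (simp add: anchor_word_hook_Cons)
  have pos: "0 < hd w" if "anchor_word (hook h l) d w" "w \<noteq> []" for w
    using that by (cases w) (auto simp: anchor_word_hook_Cons zero_enat_def)
  have "fault_free (hook h l) d w \<longleftrightarrow> w \<in> {[\<infinity>]} \<union> ff_above h l d 0" for w
    using inf pos by (auto simp: fault_free_def ff_above_def terminal_block_def zero_enat_def)
  then have "Bseries (hook h l) d = word_series ({[\<infinity>]} \<union> ff_above h l d 0)"
    unfolding Bseries_def word_series_def by (simp only:)
  also have "\<dots> = word_series {[\<infinity>]} + word_series (ff_above h l d 0)"
    by (intro word_series_Un length_finite_ff_above length_finite_finite)
      (auto simp: ff_above_def)
  also have "word_series {[\<infinity>]} = varx"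
    by (simp add: word_series_single bigtiles_eq)
  finally show ?thesis .
qed

section \<open>All anchor words in the case of two parts\<close>

definition anchor_above :: "nat \<Rightarrow> nat \<Rightarrow> nat \<Rightarrow> enat list set" where
  "anchor_above h d a = {w. anchor_word (hook h 1) d w \<and> (w \<noteq> [] \<and> enat a < hd w)}"

lemma length_finite_anchor_above: "length_finite (anchor_above h d a)"
  unfolding anchor_above_def by (rule length_finite_anchor)

lemma anchor_above_top:
  "anchor_above h d d = (@) [\<infinity>] ` {w. anchor_word (hook h 1) d w}"
proof (intro set_eqI)
  fix w
  show "w \<in> anchor_above h d d \<longleftrightarrow> w \<in> (@) [\<infinity>] ` {w. anchor_word (hook h 1) d w}"
    by (cases w) (auto simp: anchor_above_def anchor_word_hook_Cons)
qed

text \<open>For \<open>l = 1\<close> an integer is compared only with the next letter, so the tail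
  after \<open>Suc a\<close> is an arbitrary nonempty anchor word with larger first letter.\<close>

lemma anchor_above_decomp:
  assumes "Suc a \<le> d"
  shows "anchor_above h d a =
    anchor_above h d (Suc a) \<union> (@) [enat (Suc a)] ` anchor_above h d (Suc a)"
proof (intro set_eqI)
  fix w
  show "w \<in> anchor_above h d a \<longleftrightarrow>
    w \<in> anchor_above h d (Suc a) \<union> (@) [enat (Suc a)] ` anchor_above h d (Suc a)"
  proof (cases w)
    case (Cons c u)
    have u: "Suc 0 \<le> length u \<and> enat m < u ! 0 \<longleftrightarrow> u \<noteq> [] \<and> enat m < hd u" for m
      by (cases u) auto
    show ?thesis
    proof (cases c)
      case (enat m)
      then show ?thesis
        using Cons assms u[of m]
        by (cases "m = Suc a") (auto simp: anchor_above_def anchor_word_hook_Cons)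
    qed (use Cons in \<open>auto simp: anchor_above_def\<close>)
  qed (auto simp: anchor_above_def)
qed

text \<open>Each integer from \<open>d - m + 1\<close> to \<open>d\<close> is either present in the
  initial increasing run or absent, which gives one factor \<open>1 + varx * vart\<close> per
  value.\<close>

lemma word_series_anchor_above:
  assumes "m \<le> d"
  shows "word_series (anchor_above h d (d - m)) =
    (1 + varx * vart) ^ m * word_series (anchor_above h d d)"
  using assms
proof (induction m)
  case (Suc m)
  define a where "a = d - Suc m"
  have a: "Suc a = d - m" "Suc a \<le> d"
    using Suc.prems by (auto simp: a_def)
  have "word_series (anchor_above h d a) = word_series (anchor_above h d (Suc a)) +
      word_series ((@) [enat (Suc a)] ` anchor_above h d (Suc a))"
    unfolding anchor_above_decomp[OF a(2)]
    by (intro word_series_Un length_finite_append_image length_finite_anchor_above)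
      (auto simp: anchor_above_def)
  also have "\<dots> = (1 + varx * vart) * word_series (anchor_above h d (Suc a))"
    unfolding word_series_append_image by (simp add: bigtiles_eq algebra_simps)
  finally show ?case
    using Suc a by (simp add: a_def mult.assoc)
qed simp

lemma Fseries_hook_1:
  "Fseries (hook h 1) d = 1 + varx * (1 + varx * vart) ^ d * Fseries (hook h 1) d"
proof -
  have F: "Fseries (hook h 1) d = word_series {w. anchor_word (hook h 1) d w}"
    by (simp add: Fseries_def word_series_def)
  have pos: "0 < hd w" if "anchor_word (hook h 1) d w" "w \<noteq> []" for w
    using that by (cases w) (auto simp: anchor_word_hook_Cons zero_enat_def)
  have "{w. anchor_word (hook h 1) d w} = {[]} \<union> anchor_above h d 0"
    using pos by (auto simp: anchor_above_def zero_enat_def)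
  then have "Fseries (hook h 1) d = word_series {[]} + word_series (anchor_above h d 0)"
    unfolding F
    by (simp only:) (intro word_series_Un length_finite_anchor_above length_finite_finite,
      auto simp: anchor_above_def)
  also have "word_series (anchor_above h d 0) =
      (1 + varx * vart) ^ d * (varx * Fseries (hook h 1) d)"
    using word_series_anchor_above[of d d h]
    by (simp only: anchor_above_top word_series_append_image F) (simp add: bigtiles_eq)
  finally show ?thesis
    by (simp add: word_series_single bigtiles_eq mult_ac)
qed

section \<open>Binomial expansion and division of series\<close>

lemma binomial_minus_one_eq_mult:
  fixes s u :: "'a::comm_ring_1"
  shows "(1 + u * s) ^ d - 1 = (\<Sum>k=1..d. u ^ k * of_nat (d choose k) * s ^ (k - 1)) * s"
proof -
  have "(u * s + 1) ^ d = (\<Sum>k\<le>d. of_nat (d choose k) * (u * s) ^ k)"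
    by (simp add: binomial_ring)
  also have "\<dots> = 1 + (\<Sum>k=1..d. of_nat (d choose k) * (u * s) ^ k)"
    by (simp add: atMost_atLeast0 sum.atLeast_Suc_atMost)
  also have "(\<Sum>k=1..d. of_nat (d choose k) * (u * s) ^ k) =
      (\<Sum>k=1..d. u ^ k * of_nat (d choose k) * s ^ (k - 1) * s)"
  proof (rule sum.cong)
    fix k assume "k \<in> {1..d}"
    \<comment> \<open>Here \<open>k \<ge> 1\<close>, so the subtraction is not truncated.\<close>
    then have "s ^ k = s ^ (k - 1) * s"
      by (cases k) auto
    then show "of_nat (d choose k) * (u * s) ^ k = u ^ k * of_nat (d choose k) * s ^ (k - 1) * s"
      by (simp add: power_mult_distrib mult_ac)
  qed simp
  finally show ?thesis
    by (simp add: sum_distrib_right add.commute)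
qed

theorem theorem4p16:
  fixes l h d :: nat
  assumes "l \<ge> 1" and "h \<ge> 1" and "1 \<le> d" and "d \<le> h"
  shows "Bseries (hook h l) d =
           varx + varx ^ (l + 1) *
             (((1 + vart * (\<Sum>i=1..l. varx ^ i)) ^ d - 1) / (\<Sum>i=1..l. varx ^ i)) \<and>
         Bseries (hook h l) d =
           varx + (\<Sum>k=1..d. vart ^ k * of_nat (d choose k) * varx ^ (l + 1)
                     * (\<Sum>i=1..l. varx ^ i) ^ (k - 1)) \<and>
         (l = 1 \<and> d = h \<longrightarrow>
           Fseries (hook h l) d = 1 / (1 - varx * (1 + varx * vart) ^ d))"
proof -
  define S where "S = (\<Sum>i=1..l. varx ^ i)"
  define Q where "Q = (\<Sum>k=1..d. vart ^ k * of_nat (d choose k) * S ^ (k - 1))"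
  define P where "P = word_series (ff_above h l d 0)"
  have QS: "(1 + vart * S) ^ d - 1 = Q * S"
    unfolding Q_def by (rule binomial_minus_one_eq_mult)
  have quot: "Q * S / S = Q"
    unfolding S_def by (rule div_geometric[OF assms(1)])
  have PS: "P * S / S = P"
    unfolding S_def by (rule div_geometric[OF assms(1)])
  have "P * S = varx ^ (l + 1) * ((1 + vart * S) ^ d - 1)"
    using word_series_ff_above[OF assms(1), of d d h]
    by (simp add: P_def S_def algebra_simps)
  also have "\<dots> = varx ^ (l + 1) * Q * S"
    unfolding QS by (simp add: mult.assoc)
  \<comment> \<open>The factor \<open>S\<close> is cancelled by dividing both sides and evaluating
    each quotient with \<open>div_geometric\<close>.\<close>
  finally have "P * S / S = varx ^ (l + 1) * Q * S / S"
    by (simp only:)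
  then have P: "P = varx ^ (l + 1) * Q"
    using PS div_geometric[OF assms(1), of "varx ^ (l + 1) * Q"] by (simp add: S_def)
  have B: "Bseries (hook h l) d = varx + varx ^ (l + 1) * Q"
    using Bseries_hook[OF assms(1), of h d] P by (simp add: P_def)
  have "varx ^ (l + 1) * Q =
      (\<Sum>k=1..d. vart ^ k * of_nat (d choose k) * varx ^ (l + 1) * S ^ (k - 1))"
    unfolding Q_def sum_distrib_left by (simp add: mult_ac)
  moreover have "Fseries (hook h 1) d = 1 / (1 - varx * (1 + varx * vart) ^ d)"
  proof -
    let ?G = "1 - varx * (1 + varx * vart) ^ d"
    have FG: "Fseries (hook h 1) d * ?G = 1"
      using Fseries_hook_1[of h d] by (simp add: algebra_simps)
    \<comment> \<open>The constant coefficient 1 is the leading one and a unit, so dividing by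
      \<open>?G\<close> undoes multiplication by it.\<close>
    have G0: "fps_nth ?G 0 = 1"
      by simp
    then have "subdegree ?G = 0"
      by (intro subdegreeI) auto
    then have "fps_nth ?G (subdegree ?G) * inverse (fps_nth ?G (subdegree ?G)) = 1"
      using G0 by (simp only: fps_inverse_one mult_1_left)
    from fps_times_divide_unit_lead[OF this, of "Fseries (hook h 1) d"] show ?thesis
      unfolding FG by simp
  qed
  ultimately show ?thesis
    using B QS quot by (simp only: S_def[symmetric]) blast
qed

end
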